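(* Let $G$ be a position with $G = \overline{G}$ (for example $G = \{*L, *R\}$). Then for every position $G'$, $G + G' \not\equiv *L$. Hence the equivalence class of $G$ has no inverse in the monoid of equivalence classes of positions under disjunctive sum (whose identity is the class of $*L$), and therefore this monoid is not a group.
   Context: Positions are defined recursively: $*L$ and $*R$ are terminal positions; if $G_1,\dots,G_n$ ($n\ge 1$) are positions, then $\{G_1,\dots,G_n\}$ is a position with options $G_1,\dots,G_n$; $=$ denotes isomorphism of positions (same game tree up to reordering options, with matching terminal labels). All positions have finite game trees. Play: Left and Right move alternately, each choosing any option of the current position; when a terminal position is reached, Left wins if it is $*L$ and Right wins if it is $*R$. Disjunctive sum: $*L + *L = *R + *R = *L$, $*L + *R = *R + *L = *R$; if at least one of $G,H$ is non-terminal, $G+H$ has options all $G'+H$ ($G'$ an option of $G$) and all $G+H'$ ($H'$ an option of $H$). Outcome classes: $\mathcal{L}$ (Left wins moving first or second), $\mathcal{R}$ (Right wins moving first or second), $\mathcal{N}$ (first player wins), $\mathcal{P}$ (second player wins); $o(G)$ denotes the outcome class of $G$. Equivalence: $G \equiv H$ iff $o(G+X) = o(H+X)$ for every position $X$. The conjugate is defined recursively by $\overline{*L} = *R$, $\overline{*R} = *L$, and $\overline{\{G_1,\dots,G_n\}} = \{\overline{G_1},\dots,\overline{G_n}\}$. *)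

theory Defs
  imports "HOL-Library.Multiset" "HOL-Algebra.Group"
begin

datatype player = Left | Right

text \<open>Options form a multiset, so that HOL equality of trees is isomorphism: the same game tree
  up to reordering of options. The junk tree \<open>Node {#}\<close> is excluded by \<open>positions\<close>.\<close>

datatype game_tree = Terminal player | Node "game_tree multiset"

abbreviation star_L :: game_tree (\<open>*L\<close>) where "*L \<equiv> Terminal Left"
abbreviation star_R :: game_tree (\<open>*R\<close>) where "*R \<equiv> Terminal Right"

inductive_set positions :: "game_tree set" where
  terminal: "Terminal p \<in> positions"
| node: "Gs \<noteq> {#} \<Longrightarrow> (\<And>G. G \<in># Gs \<Longrightarrow> G \<in> positions) \<Longrightarrow> Node Gs \<in> positions"

fun options :: "game_tree \<Rightarrow> game_tree multiset" where
  "options (Terminal p) = {#}"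
| "options (Node Gs) = Gs"

lemma size_member_mset [termination_simp]:
  "x \<in># M \<Longrightarrow> size x < Suc (size_multiset size M)"
  by (auto dest!: multi_member_split)

lemma size_option: "G' \<in># options G \<Longrightarrow> size G' < size G"
  by (cases G) (auto simp: size_member_mset)

function gsum :: "game_tree \<Rightarrow> game_tree \<Rightarrow> game_tree" (infixl \<open>\<^bold>+\<close> 65) where
  "G \<^bold>+ H = (case (G, H) of
      (Terminal p, Terminal q) \<Rightarrow> if p = q then *L else *R
    | _ \<Rightarrow> Node ({# G' \<^bold>+ H. G' \<in># options G #} + {# G \<^bold>+ H'. H' \<in># options H #}))"
  by pat_completeness auto
termination
  by (relation "measure (\<lambda>(G, H). size G + size H)") (auto simp: size_member_mset dest: size_option)

declare gsum.simps [simp del]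

fun opponent :: "player \<Rightarrow> player" where
  "opponent Left = Right"
| "opponent Right = Left"

fun conjugate :: "game_tree \<Rightarrow> game_tree" where
  "conjugate (Terminal p) = Terminal (opponent p)"
| "conjugate (Node Gs) = Node (image_mset conjugate Gs)"

text \<open>\<open>wins p q G\<close>: player \<open>p\<close> has a winning strategy on \<open>G\<close> when player \<open>q\<close> is to move.\<close>

function wins :: "player \<Rightarrow> player \<Rightarrow> game_tree \<Rightarrow> bool" where
  "wins p q (Terminal r) \<longleftrightarrow> r = p"
| "wins p q (Node Gs) \<longleftrightarrow>
     (if q = p then \<exists>G \<in> set_mset Gs. wins p (opponent q) G
      else \<forall>G \<in> set_mset Gs. wins p (opponent q) G)"
  by pat_completeness auto
termination
  by (relation "measure (\<lambda>(p, q, G). size G)") (auto simp: size_member_mset)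

abbreviation wins_first :: "player \<Rightarrow> game_tree \<Rightarrow> bool" where
  "wins_first p G \<equiv> wins p p G"
abbreviation wins_second :: "player \<Rightarrow> game_tree \<Rightarrow> bool" where
  "wins_second p G \<equiv> wins p (opponent p) G"

datatype outcome_class = OutL | OutR | OutN | OutP

definition outcome :: "game_tree \<Rightarrow> outcome_class" where
  "outcome G =
    (if wins_first Left G \<and> wins_second Left G then OutL
     else if wins_first Right G \<and> wins_second Right G then OutR
     else if wins_first Left G \<and> wins_first Right G then OutN
     else OutP)"

lemma opponent_simps [simp]:
  "opponent (opponent p) = p" "opponent p \<noteq> p" "p \<noteq> opponent p"
  by (cases p; simp)+

lemma wins_determined: "wins (opponent p) q G \<longleftrightarrow> \<not> wins p q G"
proof (induction G arbitrary: q)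
  case (Terminal r)
  then show ?case by (cases p; cases r) auto
next
  case (Node Gs)
  then show ?case by (cases p; cases q) auto
qed

text \<open>The fall-through case of \<open>outcome\<close> is as intended: each class has its usual meaning.\<close>

lemma outcome_iff:
  "outcome G = OutL \<longleftrightarrow> wins_first Left G \<and> wins_second Left G"
  "outcome G = OutR \<longleftrightarrow> wins_first Right G \<and> wins_second Right G"
  "outcome G = OutN \<longleftrightarrow> wins_first Left G \<and> wins_first Right G"
  "outcome G = OutP \<longleftrightarrow> wins_second Left G \<and> wins_second Right G"
  using wins_determined[of Left Left G] wins_determined[of Left Right G]
  by (auto simp: outcome_def)

definition game_equiv :: "game_tree \<Rightarrow> game_tree \<Rightarrow> bool" (infix \<open>\<simeq>\<close> 50) where
  "G \<simeq> H \<longleftrightarrow> (\<forall>X \<in> positions. outcome (G \<^bold>+ X) = outcome (H \<^bold>+ X))"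

definition equiv_rel :: "game_tree rel" where
  "equiv_rel = {(G, H). G \<in> positions \<and> H \<in> positions \<and> G \<simeq> H}"

definition equiv_class :: "game_tree \<Rightarrow> game_tree set" where
  "equiv_class G = equiv_rel `` {G}"

definition position_monoid :: "game_tree set monoid" where
  "position_monoid =
    \<lparr> carrier = positions // equiv_rel,
      mult = (\<lambda>A B. \<Union>G \<in> A. \<Union>H \<in> B. equiv_class (G \<^bold>+ H)),
      one = equiv_class *L \<rparr>"

lemma gsum_Terminal: "Terminal p \<^bold>+ Terminal q = (if p = q then *L else *R)"
  by (simp add: gsum.simps)

lemma gsum_nonterminal:
  "options G \<noteq> {#} \<or> options H \<noteq> {#} \<Longrightarrow>
    G \<^bold>+ H = Node ({# G' \<^bold>+ H. G' \<in># options G #} + {# G \<^bold>+ H'. H' \<in># options H #})"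
  by (subst gsum.simps) (auto split: game_tree.splits)

lemma position_cases:
  assumes "G \<in> positions"
  obtains p where "G = Terminal p"
  | Gs where "Gs \<noteq> {#}" "G = Node Gs"
  using assms by (cases rule: positions.cases) auto

lemma option_position: "G \<in> positions \<Longrightarrow> G' \<in># options G \<Longrightarrow> G' \<in> positions"
  by (erule positions.cases) auto

lemma gsum_position:
  assumes "G \<in> positions" "H \<in> positions"
  shows "G \<^bold>+ H \<in> positions"
  using assms
proof (induction "size G + size H" arbitrary: G H rule: less_induct)
  case less
  show ?case
  proof (cases "options G \<noteq> {#} \<or> options H \<noteq> {#}")
    case True
    then show ?thesis
      using less
      by (subst gsum_nonterminal)
        (auto simp: size_option option_position intro!: positions.node)
  next
    case False
    with less.prems show ?thesis
      by (auto elim!: position_cases simp: gsum_Terminal positions.terminal)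
  qed
qed

lemma gsum_commute:
  assumes "G \<in> positions" "H \<in> positions"
  shows "G \<^bold>+ H = H \<^bold>+ G"
  using assms
proof (induction "size G + size H" arbitrary: G H rule: less_induct)
  case less
  show ?case
  proof (cases "options G \<noteq> {#} \<or> options H \<noteq> {#}")
    case True
    have "{# G' \<^bold>+ H. G' \<in># options G #} = {# H \<^bold>+ G'. G' \<in># options G #}"
      using less by (intro image_mset_cong) (simp add: size_option option_position)
    moreover have "{# G \<^bold>+ H'. H' \<in># options H #} = {# H' \<^bold>+ G. H' \<in># options H #}"
      using less by (intro image_mset_cong) (simp add: size_option option_position)
    ultimately show ?thesis
      using True by (subst (1 2) gsum_nonterminal) (auto simp: add.commute)
  next
    case False
    with less.prems show ?thesis
      by (auto elim!: position_cases simp: gsum_Terminal)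
  qed
qed

lemma options_gsum:
  assumes "G \<in> positions" "H \<in> positions"
  shows "options (G \<^bold>+ H) = {# G' \<^bold>+ H. G' \<in># options G #} + {# G \<^bold>+ H'. H' \<in># options H #}"
proof (cases "options G \<noteq> {#} \<or> options H \<noteq> {#}")
  case True
  then show ?thesis by (subst gsum_nonterminal) auto
next
  case False
  with assms show ?thesis by (auto elim!: position_cases simp: gsum_Terminal)
qed

lemma gsum_assoc:
  assumes "G \<in> positions" "H \<in> positions" "K \<in> positions"
  shows "(G \<^bold>+ H) \<^bold>+ K = G \<^bold>+ (H \<^bold>+ K)"
  using assms
proof (induction "size G + size H + size K" arbitrary: G H K rule: less_induct)
  case less
  show ?case
  proof (cases "options G \<noteq> {#} \<or> options H \<noteq> {#} \<or> options K \<noteq> {#}")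
    case True
    have 1: "{# (G' \<^bold>+ H) \<^bold>+ K. G' \<in># options G #} = {# G' \<^bold>+ (H \<^bold>+ K). G' \<in># options G #}"
      using less by (intro image_mset_cong) (simp add: size_option option_position)
    have 2: "{# (G \<^bold>+ H') \<^bold>+ K. H' \<in># options H #} = {# G \<^bold>+ (H' \<^bold>+ K). H' \<in># options H #}"
      using less by (intro image_mset_cong) (simp add: size_option option_position)
    have 3: "{# (G \<^bold>+ H) \<^bold>+ K'. K' \<in># options K #} = {# G \<^bold>+ (H \<^bold>+ K'). K' \<in># options K #}"
      using less by (intro image_mset_cong) (simp add: size_option option_position)
    have "options (G \<^bold>+ H) \<noteq> {#} \<or> options K \<noteq> {#}"
      "options G \<noteq> {#} \<or> options (H \<^bold>+ K) \<noteq> {#}"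
      using True less.prems by (auto simp: options_gsum)
    then show ?thesis
      using less.prems 1 2 3
      by (simp add: gsum_nonterminal[of "G \<^bold>+ H" K] gsum_nonterminal[of G "H \<^bold>+ K"]
          options_gsum multiset.map_comp comp_def add.assoc)
  next
    case False
    with less.prems obtain p q r where "G = Terminal p" "H = Terminal q" "K = Terminal r"
      by (auto elim!: position_cases)
    then show ?thesis
      by (cases p; cases q; cases r) (simp_all add: gsum_Terminal)
  qed
qed

lemma gsum_star_L:
  assumes "G \<in> positions"
  shows "G \<^bold>+ *L = G"
  using assms
proof (induction G rule: positions.induct)
  case (terminal p)
  then show ?case by (cases p) (simp_all add: gsum_Terminal)
next
  case (node Gs)
  then have "{# G \<^bold>+ *L. G \<in># Gs #} = {# G. G \<in># Gs #}"
    by (intro image_mset_cong) simp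
  with node show ?case by (subst gsum_nonterminal) auto
qed

lemma equiv_equiv_rel: "equiv positions equiv_rel"
  by (rule equivI) (auto simp: equiv_rel_def game_equiv_def refl_on_def sym_def trans_def)

lemma gsum_cong:
  assumes "(G, G') \<in> equiv_rel" "(H, H') \<in> equiv_rel"
  shows "(G \<^bold>+ H, G' \<^bold>+ H') \<in> equiv_rel"
proof -
  have pos: "G \<in> positions" "G' \<in> positions" "H \<in> positions" "H' \<in> positions"
    using assms by (auto simp: equiv_rel_def)
  have "outcome ((G \<^bold>+ H) \<^bold>+ X) = outcome ((G' \<^bold>+ H') \<^bold>+ X)" if X: "X \<in> positions" for X
  proof -
    have "outcome ((G \<^bold>+ H) \<^bold>+ X) = outcome (G \<^bold>+ (H \<^bold>+ X))"
      using pos X by (simp add: gsum_assoc)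
    also have "\<dots> = outcome (G' \<^bold>+ (H \<^bold>+ X))"
      using assms(1) pos X by (simp add: equiv_rel_def game_equiv_def gsum_position)
    also have "G' \<^bold>+ (H \<^bold>+ X) = H \<^bold>+ (X \<^bold>+ G')"
      using pos X by (metis gsum_assoc gsum_commute gsum_position)
    also have "outcome \<dots> = outcome (H' \<^bold>+ (X \<^bold>+ G'))"
      using assms(2) pos X by (simp add: equiv_rel_def game_equiv_def gsum_position)
    also have "H' \<^bold>+ (X \<^bold>+ G') = (G' \<^bold>+ H') \<^bold>+ X"
      using pos X by (metis gsum_assoc gsum_commute gsum_position)
    finally show ?thesis .
  qed
  with pos show ?thesis by (simp add: equiv_rel_def game_equiv_def gsum_position)
qed

text \<open>The multiplication of \<open>position_monoid\<close> is well defined on classes.\<close>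

lemma mult_equiv_class:
  assumes "G \<in> positions" "H \<in> positions"
  shows "equiv_class G \<otimes>\<^bsub>position_monoid\<^esub> equiv_class H = equiv_class (G \<^bold>+ H)"
proof -
  have eq: "equiv_class (G' \<^bold>+ H') = equiv_class (G \<^bold>+ H)"
    if "G' \<in> equiv_class G" "H' \<in> equiv_class H" for G' H'
    using equiv_class_eq[OF equiv_equiv_rel gsum_cong[of G G' H H']] that
    by (simp add: equiv_class_def)
  have "G \<in> equiv_class G" "H \<in> equiv_class H"
    using assms by (auto simp: equiv_class_def equiv_rel_def game_equiv_def)
  then have "(\<Union>G' \<in> equiv_class G. \<Union>H' \<in> equiv_class H. equiv_class (G' \<^bold>+ H'))
      = equiv_class (G \<^bold>+ H)"
    using eq by blast
  then show ?thesis by (simp add: position_monoid_def)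
qed

lemma carrier_position_monoid: "carrier position_monoid = equiv_class ` positions"
  by (auto simp: position_monoid_def equiv_class_def quotient_def)

lemma one_position_monoid: "\<one>\<^bsub>position_monoid\<^esub> = equiv_class *L"
  by (simp add: position_monoid_def)

lemma comm_monoid_position_monoid: "comm_monoid position_monoid"
  by (rule comm_monoidI; unfold carrier_position_monoid one_position_monoid)
    (auto simp: mult_equiv_class gsum_position positions.terminal gsum_assoc gsum_star_L
      gsum_commute[of "*L"], (metis gsum_commute)+)

end

theory Submission
  imports Defs
begin

text \<open>Adding \<open>*R\<close> swaps all terminal labels, so the conjugate of \<open>G\<close> is \<open>G + *R\<close>. Hence any sum
  with a self-conjugate summand is self-conjugate. Conjugation exchanges the two players, so a
  self-conjugate position is never a win for Left both moving first and moving second, whereas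
  \<open>*L\<close> is.\<close>

text \<open>A terminal summand offers no moves, so the sum keeps the tree of \<open>G\<close> and
  only its leaves change, by the rule for two terminals.\<close>

lemma gsum_star_R:
  assumes "G \<in> positions"
  shows "G \<^bold>+ *R = conjugate G"
  using assms
proof (induction G rule: positions.induct)
  case (terminal p)
  then show ?case by (cases p) (simp_all add: gsum_Terminal)
next
  case (node Gs)
  then have "{# G \<^bold>+ *R. G \<in># Gs #} = {# conjugate G. G \<in># Gs #}"
    by (intro image_mset_cong) simp
  with node show ?case by (subst gsum_nonterminal) auto
qed

text \<open>Conjugation is addition of \<open>*R\<close>, which associativity and commutativity move
  onto a single summand. Conjugating both summands would add \<open>*R\<close> twice and
  cancel.\<close>

lemma conjugate_gsum:
  assumes "G \<in> positions" "H \<in> positions"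
  shows "conjugate (G \<^bold>+ H) = conjugate G \<^bold>+ H"
proof -
  have "conjugate (G \<^bold>+ H) = (G \<^bold>+ H) \<^bold>+ *R"
    using assms by (simp add: gsum_star_R gsum_position)
  also have "\<dots> = (G \<^bold>+ *R) \<^bold>+ H"
    using assms positions.terminal[of Right] by (metis gsum_assoc gsum_commute)
  finally show ?thesis
    using assms by (simp add: gsum_star_R)
qed

lemma opponent_eq_iff [simp]: "opponent p = opponent q \<longleftrightarrow> p = q"
  by (cases p; cases q) simp_all

lemma wins_conjugate: "wins (opponent p) (opponent q) (conjugate G) \<longleftrightarrow> wins p q G"
proof (induction G arbitrary: q)
  case (Terminal r)
  then show ?case by simp
next
  case (Node Gs)
  \<comment> \<open>The induction hypothesis at \<open>opponent q\<close>, since the turn passes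
    after a move; the double \<open>opponent\<close> collapses.\<close>
  then have "wins (opponent p) q (conjugate G) \<longleftrightarrow> wins p (opponent q) G" if "G \<in># Gs" for G
    using that by (metis opponent_simps(1))
  then show ?case by auto
qed

text \<open>By symmetry, if Left wins moving first then so does Right, and then Left loses moving
  second.\<close>

lemma outcome_self_conjugate:
  assumes "conjugate G = G"
  shows "outcome G \<noteq> OutL"
  using wins_conjugate[of Left Left G] wins_determined[of Left Right G] assms
  by (auto simp: outcome_iff)

lemma self_conjugate_not_invertible:
  assumes "G \<in> positions" "conjugate G = G" "H \<in> positions"
  shows "\<not> G \<^bold>+ H \<simeq> *L"
proof
  assume "G \<^bold>+ H \<simeq> *L"
  \<comment> \<open>The neutral \<open>*L\<close> as test position compares the outcomes of the two
    sides themselves.\<close>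
  then have "outcome ((G \<^bold>+ H) \<^bold>+ *L) = outcome (*L \<^bold>+ *L)"
    by (simp add: game_equiv_def positions.terminal)
  then have "outcome (G \<^bold>+ H) = OutL"
    using assms by (simp add: gsum_star_L gsum_position gsum_Terminal outcome_iff)
  then show False
    using outcome_self_conjugate[of "G \<^bold>+ H"] assms by (simp add: conjugate_gsum)
qed

text \<open>Any inverse class has a representative \<open>H\<close>, which turns invertibility in
  the monoid into a statement about positions.\<close>

lemma equiv_class_Units_imp_inverse:
  assumes "G \<in> positions" "equiv_class G \<in> Units position_monoid"
  obtains H where "H \<in> positions" "G \<^bold>+ H \<simeq> *L"
proof -
  obtain H where H: "H \<in> positions"
    and "equiv_class G \<otimes>\<^bsub>position_monoid\<^esub> equiv_class H = \<one>\<^bsub>position_monoid\<^esub>"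
    using assms(2) by (auto simp: Units_def carrier_position_monoid)
  then have "equiv_class (G \<^bold>+ H) = equiv_class *L"
    using assms(1) by (simp add: mult_equiv_class one_position_monoid)
  then have "(G \<^bold>+ H, *L) \<in> equiv_rel"
    unfolding equiv_class_def
    by (rule eq_equiv_class[OF _ equiv_equiv_rel positions.terminal])
  then show thesis
    using that H by (simp add: equiv_rel_def)
qed

theorem theorem2p17:
  shows "(\<forall>G \<in> positions. G = conjugate G \<longrightarrow>
            (\<forall>G' \<in> positions. \<not> (G \<^bold>+ G' \<simeq> *L)) \<and>
            equiv_class G \<notin> Units position_monoid) \<and>
         Node {#*L, *R#} \<in> positions \<and> Node {#*L, *R#} = conjugate (Node {#*L, *R#}) \<and>
         monoid position_monoid \<and> \<not> group position_monoid"
proof (intro conjI ballI impI)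
  fix G G'
  assume "G \<in> positions" "G = conjugate G" "G' \<in> positions"
  then show "\<not> G \<^bold>+ G' \<simeq> *L"
    by (simp add: self_conjugate_not_invertible)
next
  have not_unit: "equiv_class G \<notin> Units position_monoid"
    if "G \<in> positions" "G = conjugate G" for G
    using that by (metis equiv_class_Units_imp_inverse self_conjugate_not_invertible)
  then show "equiv_class G \<notin> Units position_monoid"
    if "G \<in> positions" "G = conjugate G" for G
    using that by blast
  show pos: "Node {#*L, *R#} \<in> positions"
    by (rule positions.node) (auto intro: positions.terminal)
  \<comment> \<open>Conjugation swaps the two leaves, and multisets ignore order.\<close>
  show conj: "Node {#*L, *R#} = conjugate (Node {#*L, *R#})"
    by (simp add: add_mset_commute)
  show "monoid position_monoid"
    using comm_monoid_position_monoid by (rule comm_monoid.axioms)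
  show "\<not> group position_monoid"
  proof
    assume "group position_monoid"
    then have "Units position_monoid = carrier position_monoid"
      by (rule group.Units_eq)
    with not_unit[OF pos conj] pos show False
      by (simp add: carrier_position_monoid)
  qed
qed

end
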